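(* Let $k$ be a field, let $\Phi:\mathcal{T}\to\mathcal{S}$ be an exact, fully faithful functor between $k$-linear triangulated categories $\mathcal{T}$ and $\mathcal{S}$, and let $(C_\bullet,N)$ be a P-datum in $\mathcal{T}$. Then an object $A\in\mathcal{T}$ is P-stable with respect to $(C_\bullet,N)$ if and only if $\Phi(A)\in\mathcal{S}$ is P-stable with respect to $(\Phi(C_\bullet),N)$.
   Context: For objects $a,b$ of a $k$-linear triangulated category write $\mathrm{Hom}^i(a,b)=\mathrm{Hom}(a,b[i])$, $\hom^i(a,b)=\dim_k\mathrm{Hom}^i(a,b)$, and $\mathrm{Hom}^*(a,b)=\bigoplus_i\mathrm{Hom}^i(a,b)$. P-datum: a P-datum (Postnikov-datum) in $\mathcal{T}$ is a finite collection $C_d,C_{d-1},\dots,C_{e+1},C_e$ of objects of $\mathcal{T}$ (indexed by integers $d\ge j\ge e$) together with nonnegative integers $N^i_j$ ($i,j\in\mathbb{Z}$), only finitely many of which are nonzero. It is written $(C_\bullet,N)$; $\Phi(C_\bullet)$ denotes the collection $\Phi(C_d),\dots,\Phi(C_e)$. Postnikov system and convolution: given objects $A_n,\dots,A_0$ and morphisms $d_i:A_{i+1}\to A_i$ with $d^2=0$ (i.e. $d_i\circ d_{i+1}=0$), a Postnikov system subordinated to them consists of objects $T_n=A_n,T_{n-1},\dots,T_0$ and distinguished triangles $T_{i+1}\to A_i\to T_i\to T_{i+1}[1]$ for $i=n-1,\dots,0$, such that each $d_i$ equals the composition $A_{i+1}\to T_{i+1}\to A_i$ (where $A_n\to T_n$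 is the identity). The object $T_0$ is called a convolution. Convolutions need not exist or be unique. P-stability: an object $A\in\mathcal{T}$ is P-stable with respect to $(C_\bullet,N)$ if (i) $\hom^i_{\mathcal{T}}(C_j,A)=N^i_j$ for all $j=d,\dots,e$ and all $i$; (ii) for $j>0$ there are morphisms $d_j:C_j\to C_{j-1}$ such that $d^2=0$ and such that the complex $(C_{\bullet\ge 0},d_\bullet)$, formed by the $C_j$ with $j\ge0$, admits a convolution $K$; (iii) $\mathrm{Hom}^*_{\mathcal{T}}(A,K)=0$. *)

theory Defs
  imports "Jordan_Normal_Form.Missing_VectorSpace" "HOL-Library.Extended_Nat"
begin

section \<open>Linear categories and functors\<close>

text \<open>
  Each hom-set is an HOL-Algebra module over the ring of scalars; the fields \<open>mult\<close> and \<open>one\<close>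
  that a module record inherits from rings carry no information.
\<close>

record ('o, 'm, 'k) lcat =
  Obj :: "'o set"
  Hom :: "'o \<Rightarrow> 'o \<Rightarrow> ('k, 'm) module"
  Id :: "'o \<Rightarrow> 'm"
  Comp :: "'m \<Rightarrow> 'm \<Rightarrow> 'm"  (infixr \<open>\<bullet>\<index>\<close> 75)

abbreviation Mor :: "('o, 'm, 'k, 'z) lcat_scheme \<Rightarrow> 'o \<Rightarrow> 'o \<Rightarrow> 'm set" where
  "Mor C a b \<equiv> carrier (Hom C a b)"

abbreviation Zero :: "('o, 'm, 'k, 'z) lcat_scheme \<Rightarrow> 'o \<Rightarrow> 'o \<Rightarrow> 'm" where
  "Zero C a b \<equiv> \<zero>\<^bsub>Hom C a b\<^esub>"

text \<open>
  Composition and the morphism part of a functor are not indexed by objects, so hom-sets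
  are required to be disjoint (every morphism determines its source and target).
\<close>

locale linear_category =
  fixes k :: "('k, 'r) ring_scheme" and C :: "('o, 'm, 'k, 'z) lcat_scheme"
  assumes Hom_vectorspace:
      "\<lbrakk>a \<in> Obj C; b \<in> Obj C\<rbrakk> \<Longrightarrow> vectorspace k (Hom C a b)"
    and Hom_disjoint:
      "\<lbrakk>a \<in> Obj C; b \<in> Obj C; a' \<in> Obj C; b' \<in> Obj C; f \<in> Mor C a b; f \<in> Mor C a' b'\<rbrakk>
        \<Longrightarrow> a = a' \<and> b = b'"
    and Id_closed: "a \<in> Obj C \<Longrightarrow> Id C a \<in> Mor C a a"
    and Comp_linear_left:
      "\<lbrakk>a \<in> Obj C; b \<in> Obj C; c \<in> Obj C; f \<in> Mor C a b\<rbrakk>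
        \<Longrightarrow> linear_map k (Hom C b c) (Hom C a c) (\<lambda>g. g \<bullet>\<^bsub>C\<^esub> f)"
    and Comp_linear_right:
      "\<lbrakk>a \<in> Obj C; b \<in> Obj C; c \<in> Obj C; g \<in> Mor C b c\<rbrakk>
        \<Longrightarrow> linear_map k (Hom C a b) (Hom C a c) (\<lambda>f. g \<bullet>\<^bsub>C\<^esub> f)"
    and Id_right: "\<lbrakk>a \<in> Obj C; b \<in> Obj C; f \<in> Mor C a b\<rbrakk> \<Longrightarrow> f \<bullet>\<^bsub>C\<^esub> Id C a = f"
    and Id_left: "\<lbrakk>a \<in> Obj C; b \<in> Obj C; f \<in> Mor C a b\<rbrakk> \<Longrightarrow> Id C b \<bullet>\<^bsub>C\<^esub> f = f"
    and Comp_assoc: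
      "\<lbrakk>a \<in> Obj C; b \<in> Obj C; c \<in> Obj C; d \<in> Obj C;
        f \<in> Mor C a b; g \<in> Mor C b c; h \<in> Mor C c d\<rbrakk>
        \<Longrightarrow> (h \<bullet>\<^bsub>C\<^esub> g) \<bullet>\<^bsub>C\<^esub> f = h \<bullet>\<^bsub>C\<^esub> (g \<bullet>\<^bsub>C\<^esub> f)"

definition is_iso :: "('o, 'm, 'k, 'z) lcat_scheme \<Rightarrow> 'o \<Rightarrow> 'o \<Rightarrow> 'm \<Rightarrow> bool" where
  "is_iso C a b f \<longleftrightarrow>
     f \<in> Mor C a b \<and> (\<exists>g \<in> Mor C b a. g \<bullet>\<^bsub>C\<^esub> f = Id C a \<and> f \<bullet>\<^bsub>C\<^esub> g = Id C b)"

definition zero_object :: "('o, 'm, 'k, 'z) lcat_scheme \<Rightarrow> 'o \<Rightarrow> bool" where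
  "zero_object C z \<longleftrightarrow>
     z \<in> Obj C \<and> (\<forall>a \<in> Obj C. (\<exists>!f. f \<in> Mor C a z) \<and> (\<exists>!f. f \<in> Mor C z a))"

definition is_biproduct ::
  "('o, 'm, 'k, 'z) lcat_scheme \<Rightarrow> 'o \<Rightarrow> 'o \<Rightarrow> 'o \<Rightarrow> 'm \<Rightarrow> 'm \<Rightarrow> 'm \<Rightarrow> 'm \<Rightarrow> bool" where
  "is_biproduct C a b s i\<^sub>1 i\<^sub>2 p\<^sub>1 p\<^sub>2 \<longleftrightarrow>
     i\<^sub>1 \<in> Mor C a s \<and> i\<^sub>2 \<in> Mor C b s \<and> p\<^sub>1 \<in> Mor C s a \<and> p\<^sub>2 \<in> Mor C s b \<and>
     p\<^sub>1 \<bullet>\<^bsub>C\<^esub> i\<^sub>1 = Id C a \<and> p\<^sub>2 \<bullet>\<^bsub>C\<^esub> i\<^sub>2 = Id C b \<and>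
     (i\<^sub>1 \<bullet>\<^bsub>C\<^esub> p\<^sub>1) \<oplus>\<^bsub>Hom C s s\<^esub> (i\<^sub>2 \<bullet>\<^bsub>C\<^esub> p\<^sub>2) = Id C s"

locale additive_category = linear_category +
  assumes zero_object_exists: "\<exists>z. zero_object C z"
    and biproduct_exists:
      "\<lbrakk>a \<in> Obj C; b \<in> Obj C\<rbrakk> \<Longrightarrow> \<exists>s \<in> Obj C. \<exists>i\<^sub>1 i\<^sub>2 p\<^sub>1 p\<^sub>2. is_biproduct C a b s i\<^sub>1 i\<^sub>2 p\<^sub>1 p\<^sub>2"

record ('o, 'm, 'o2, 'm2) fdata =
  omap :: "'o \<Rightarrow> 'o2"
  mmap :: "'m \<Rightarrow> 'm2"

definition id_fdata :: "('o, 'm, 'o, 'm) fdata" where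
  "id_fdata = \<lparr>omap = (\<lambda>a. a), mmap = (\<lambda>f. f)\<rparr>"

definition comp_fdata ::
  "('o2, 'm2, 'o3, 'm3) fdata \<Rightarrow> ('o1, 'm1, 'o2, 'm2) fdata \<Rightarrow> ('o1, 'm1, 'o3, 'm3) fdata"
  where
  "comp_fdata G F = \<lparr>omap = omap G \<circ> omap F, mmap = mmap G \<circ> mmap F\<rparr>"

locale linear_functor =
  Dom: linear_category k C + Cod: linear_category k D
  for k :: "('k, 'r) ring_scheme"
    and C :: "('o, 'm, 'k, 'z) lcat_scheme" and D :: "('o2, 'm2, 'k, 'z2) lcat_scheme" +
  fixes F :: "('o, 'm, 'o2, 'm2) fdata"
  assumes omap_closed: "a \<in> Obj C \<Longrightarrow> omap F a \<in> Obj D"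
    and mmap_linear:
      "\<lbrakk>a \<in> Obj C; b \<in> Obj C\<rbrakk>
        \<Longrightarrow> linear_map k (Hom C a b) (Hom D (omap F a) (omap F b)) (mmap F)"
    and mmap_Id: "a \<in> Obj C \<Longrightarrow> mmap F (Id C a) = Id D (omap F a)"
    and mmap_Comp:
      "\<lbrakk>a \<in> Obj C; b \<in> Obj C; c \<in> Obj C; f \<in> Mor C a b; g \<in> Mor C b c\<rbrakk>
        \<Longrightarrow> mmap F (g \<bullet>\<^bsub>C\<^esub> f) = mmap F g \<bullet>\<^bsub>D\<^esub> mmap F f"

definition natural_iso ::
  "('o, 'm, 'k, 'z) lcat_scheme \<Rightarrow> ('o2, 'm2, 'k, 'z2) lcat_scheme \<Rightarrow>
   ('o, 'm, 'o2, 'm2) fdata \<Rightarrow> ('o, 'm, 'o2, 'm2) fdata \<Rightarrow> ('o \<Rightarrow> 'm2) \<Rightarrow> bool" where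
  "natural_iso C D F G \<eta> \<longleftrightarrow>
     (\<forall>a \<in> Obj C. is_iso D (omap F a) (omap G a) (\<eta> a)) \<and>
     (\<forall>a \<in> Obj C. \<forall>b \<in> Obj C. \<forall>f \<in> Mor C a b.
        \<eta> b \<bullet>\<^bsub>D\<^esub> mmap F f = mmap G f \<bullet>\<^bsub>D\<^esub> \<eta> a)"

definition fully_faithful ::
  "('o, 'm, 'k, 'z) lcat_scheme \<Rightarrow> ('o2, 'm2, 'k, 'z2) lcat_scheme \<Rightarrow>
   ('o, 'm, 'o2, 'm2) fdata \<Rightarrow> bool" where
  "fully_faithful C D F \<longleftrightarrow>
     (\<forall>a \<in> Obj C. \<forall>b \<in> Obj C. bij_betw (mmap F) (Mor C a b) (Mor D (omap F a) (omap F b)))"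


section \<open>Triangulated categories\<close>

text \<open>
  The translation functor is an autoequivalence; \<open>Unshift\<close> is a chosen quasi-inverse, used to form
  negative shifts. Translation by an automorphism is the case where \<open>Unshift\<close> is its inverse.
  An element \<open>(a, b, c, f, g, h)\<close> of \<open>Tri\<close> is a distinguished triangle
  \<open>f: a \<rightarrow> b\<close>, \<open>g: b \<rightarrow> c\<close>, \<open>h: c \<rightarrow> a[1]\<close>.
\<close>

type_synonym ('o, 'm) sextuple = "'o \<times> 'o \<times> 'o \<times> 'm \<times> 'm \<times> 'm"

record ('o, 'm, 'k) tcat = "('o, 'm, 'k) lcat" +
  Shift :: "('o, 'm, 'o, 'm) fdata"
  Unshift :: "('o, 'm, 'o, 'm) fdata"
  Tri :: "('o, 'm) sextuple set"

abbreviation sho :: "('o, 'm, 'k, 'z) tcat_scheme \<Rightarrow> 'o \<Rightarrow> 'o" where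
  "sho T \<equiv> omap (Shift T)"

abbreviation shm :: "('o, 'm, 'k, 'z) tcat_scheme \<Rightarrow> 'm \<Rightarrow> 'm" where
  "shm T \<equiv> mmap (Shift T)"

definition is_triangle :: "('o, 'm, 'k, 'z) tcat_scheme \<Rightarrow> ('o, 'm) sextuple \<Rightarrow> bool" where
  "is_triangle T = (\<lambda>(a, b, c, f, g, h).
     a \<in> Obj T \<and> b \<in> Obj T \<and> c \<in> Obj T \<and>
     f \<in> Mor T a b \<and> g \<in> Mor T b c \<and> h \<in> Mor T c (sho T a))"

definition triangle_morphism ::
  "('o, 'm, 'k, 'z) tcat_scheme \<Rightarrow> ('o, 'm) sextuple \<Rightarrow> ('o, 'm) sextuple \<Rightarrow>
   'm \<Rightarrow> 'm \<Rightarrow> 'm \<Rightarrow> bool" where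
  "triangle_morphism T = (\<lambda>(a, b, c, f, g, h) (a', b', c', f', g', h') u v w.
     u \<in> Mor T a a' \<and> v \<in> Mor T b b' \<and> w \<in> Mor T c c' \<and>
     v \<bullet>\<^bsub>T\<^esub> f = f' \<bullet>\<^bsub>T\<^esub> u \<and> w \<bullet>\<^bsub>T\<^esub> g = g' \<bullet>\<^bsub>T\<^esub> v \<and> shm T u \<bullet>\<^bsub>T\<^esub> h = h' \<bullet>\<^bsub>T\<^esub> w)"

locale triangulated_category = additive_category k T
  for k :: "('k, 'r) ring_scheme" and T :: "('o, 'm, 'k, 'z) tcat_scheme" +
  assumes Shift_functor: "linear_functor k T T (Shift T)"
    and Unshift_functor: "linear_functor k T T (Unshift T)"
    and Unshift_Shift: "\<exists>\<eta>. natural_iso T T id_fdata (comp_fdata (Unshift T) (Shift T)) \<eta>"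
    and Shift_Unshift: "\<exists>\<epsilon>. natural_iso T T (comp_fdata (Shift T) (Unshift T)) id_fdata \<epsilon>"
    and Tri_triangle: "t \<in> Tri T \<Longrightarrow> is_triangle T t"
    and TR1_iso:
      "\<lbrakk>(a, b, c, f, g, h) \<in> Tri T; is_triangle T (a', b', c', f', g', h');
        triangle_morphism T (a, b, c, f, g, h) (a', b', c', f', g', h') u v w;
        is_iso T a a' u; is_iso T b b' v; is_iso T c c' w\<rbrakk>
        \<Longrightarrow> (a', b', c', f', g', h') \<in> Tri T"
    and TR1_id:
      "\<lbrakk>a \<in> Obj T; zero_object T z\<rbrakk>
        \<Longrightarrow> (a, a, z, Id T a, Zero T a z, Zero T z (sho T a)) \<in> Tri T"
    and TR1_cone:
      "\<lbrakk>a \<in> Obj T; b \<in> Obj T; f \<in> Mor T a b\<rbrakk> \<Longrightarrow> \<exists>c g h. (a, b, c, f, g, h) \<in> Tri T"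
    and TR2:
      "is_triangle T (a, b, c, f, g, h) \<Longrightarrow>
        (a, b, c, f, g, h) \<in> Tri T \<longleftrightarrow>
        (b, c, sho T a, g, h, \<ominus>\<^bsub>Hom T (sho T a) (sho T b)\<^esub> (shm T f)) \<in> Tri T"
    and TR3:
      "\<lbrakk>(a, b, c, f, g, h) \<in> Tri T; (a', b', c', f', g', h') \<in> Tri T;
        u \<in> Mor T a a'; v \<in> Mor T b b'; v \<bullet>\<^bsub>T\<^esub> f = f' \<bullet>\<^bsub>T\<^esub> u\<rbrakk>
        \<Longrightarrow> \<exists>w. triangle_morphism T (a, b, c, f, g, h) (a', b', c', f', g', h') u v w"
    and TR4:
      "\<lbrakk>(x, y, z', u, j, l) \<in> Tri T; (y, z, x', v, m, i) \<in> Tri T;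
        (x, z, y', v \<bullet>\<^bsub>T\<^esub> u, n, q) \<in> Tri T\<rbrakk>
        \<Longrightarrow> \<exists>f g. (z', y', x', f, g, shm T j \<bullet>\<^bsub>T\<^esub> i) \<in> Tri T \<and>
              f \<bullet>\<^bsub>T\<^esub> j = n \<bullet>\<^bsub>T\<^esub> v \<and> q \<bullet>\<^bsub>T\<^esub> f = l \<and>
              g \<bullet>\<^bsub>T\<^esub> n = m \<and> i \<bullet>\<^bsub>T\<^esub> g = shm T u \<bullet>\<^bsub>T\<^esub> q"

locale exact_functor =
  Dom: triangulated_category k T + Cod: triangulated_category k S + linear_functor k T S \<Phi>
  for k :: "('k, 'r) ring_scheme"
    and T :: "('o, 'm, 'k, 'z) tcat_scheme" and S :: "('o2, 'm2, 'k, 'z2) tcat_scheme"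
    and \<Phi> :: "('o, 'm, 'o2, 'm2) fdata" +
  assumes exact:
    "\<exists>\<eta>. natural_iso T S (comp_fdata \<Phi> (Shift T)) (comp_fdata (Shift S) \<Phi>) \<eta> \<and>
       (\<forall>a b c f g h. (a, b, c, f, g, h) \<in> Tri T \<longrightarrow>
          (omap \<Phi> a, omap \<Phi> b, omap \<Phi> c, mmap \<Phi> f, mmap \<Phi> g, \<eta> a \<bullet>\<^bsub>S\<^esub> mmap \<Phi> h) \<in> Tri S)"

definition shift_obj :: "('o, 'm, 'k, 'z) tcat_scheme \<Rightarrow> int \<Rightarrow> 'o \<Rightarrow> 'o" where
  "shift_obj T i a =
     (if 0 \<le> i then (omap (Shift T) ^^ nat i) a else (omap (Unshift T) ^^ nat (- i)) a)"

definition Hom_deg :: "('o, 'm, 'k, 'z) tcat_scheme \<Rightarrow> int \<Rightarrow> 'o \<Rightarrow> 'o \<Rightarrow> ('k, 'm) module" where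
  "Hom_deg T i a b = Hom T a (shift_obj T i b)"

text \<open>The direct sum of all \<open>Hom_deg T i a b\<close>, as finitely supported families.\<close>

definition Hom_star :: "('o, 'm, 'k, 'z) tcat_scheme \<Rightarrow> 'o \<Rightarrow> 'o \<Rightarrow> ('k, int \<Rightarrow> 'm) module" where
  "Hom_star T a b =
     \<lparr>carrier = {\<phi>. (\<forall>i. \<phi> i \<in> carrier (Hom_deg T i a b)) \<and> finite {i. \<phi> i \<noteq> \<zero>\<^bsub>Hom_deg T i a b\<^esub>}},
      mult = undefined,
      one = undefined,
      zero = (\<lambda>i. \<zero>\<^bsub>Hom_deg T i a b\<^esub>),
      add = (\<lambda>\<phi> \<psi> i. \<phi> i \<oplus>\<^bsub>Hom_deg T i a b\<^esub> \<psi> i),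
      smult = (\<lambda>r \<phi> i. r \<odot>\<^bsub>Hom_deg T i a b\<^esub> \<phi> i)\<rparr>"

definition vs_dim :: "('k, 'r) ring_scheme \<Rightarrow> ('k, 'm, 'z) module_scheme \<Rightarrow> enat" where
  "vs_dim k V = (if vectorspace.fin_dim k V then enat (vectorspace.dim k V) else \<infinity>)"

definition hom_dim ::
  "('k, 'r) ring_scheme \<Rightarrow> ('o, 'm, 'k, 'z) tcat_scheme \<Rightarrow> int \<Rightarrow> 'o \<Rightarrow> 'o \<Rightarrow> enat" where
  "hom_dim k T i a b = vs_dim k (Hom_deg T i a b)"


section \<open>Postnikov systems and P-stability\<close>

text \<open>A complex \<open>A n \<rightarrow> \<dots> \<rightarrow> A 0\<close> with differentials \<open>\<delta> i : A (i + 1) \<rightarrow> A i\<close> for \<open>i < n\<close>.\<close>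

definition is_complex ::
  "('o, 'm, 'k, 'z) lcat_scheme \<Rightarrow> nat \<Rightarrow> (nat \<Rightarrow> 'o) \<Rightarrow> (nat \<Rightarrow> 'm) \<Rightarrow> bool" where
  "is_complex T n A \<delta> \<longleftrightarrow>
     (\<forall>i \<le> n. A i \<in> Obj T) \<and>
     (\<forall>i < n. \<delta> i \<in> Mor T (A (i + 1)) (A i)) \<and>
     (\<forall>i. i + 1 < n \<longrightarrow> \<delta> i \<bullet>\<^bsub>T\<^esub> \<delta> (i + 1) = Zero T (A (i + 2)) (A i))"

text \<open>
  The triangles are \<open>X (i + 1) \<rightarrow> A i \<rightarrow> X i \<rightarrow> X (i + 1)[1]\<close> with morphisms \<open>p i\<close>, \<open>q i\<close>, \<open>r i\<close>;
  \<open>q n\<close> is the identity \<open>A n \<rightarrow> X n\<close>.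
\<close>

definition postnikov_system ::
  "('o, 'm, 'k, 'z) tcat_scheme \<Rightarrow> nat \<Rightarrow> (nat \<Rightarrow> 'o) \<Rightarrow> (nat \<Rightarrow> 'm) \<Rightarrow>
   (nat \<Rightarrow> 'o) \<Rightarrow> (nat \<Rightarrow> 'm) \<Rightarrow> (nat \<Rightarrow> 'm) \<Rightarrow> (nat \<Rightarrow> 'm) \<Rightarrow> bool" where
  "postnikov_system T n A \<delta> X p q r \<longleftrightarrow>
     X n = A n \<and> q n = Id T (A n) \<and>
     (\<forall>i < n. (X (i + 1), A i, X i, p i, q i, r i) \<in> Tri T \<and> \<delta> i = p i \<bullet>\<^bsub>T\<^esub> q (i + 1))"

definition is_convolution ::
  "('o, 'm, 'k, 'z) tcat_scheme \<Rightarrow> nat \<Rightarrow> (nat \<Rightarrow> 'o) \<Rightarrow> (nat \<Rightarrow> 'm) \<Rightarrow> 'o \<Rightarrow> bool" where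
  "is_convolution T n A \<delta> Y \<longleftrightarrow>
     is_complex T n A \<delta> \<and> (\<exists>X p q r. postnikov_system T n A \<delta> X p q r \<and> Y = X 0)"

definition P_datum ::
  "('o, 'm, 'k, 'z) tcat_scheme \<Rightarrow> int \<Rightarrow> int \<Rightarrow> (int \<Rightarrow> 'o) \<Rightarrow> (int \<Rightarrow> int \<Rightarrow> nat) \<Rightarrow> bool" where
  "P_datum T d e C N \<longleftrightarrow>
     e \<le> d \<and> (\<forall>j \<in> {e..d}. C j \<in> Obj T) \<and> finite {(i, j). N i j \<noteq> 0}"

text \<open>
  \<open>Y\<close> is a convolution of the part of the complex \<open>C\<close>, \<open>\<delta> j : C j \<rightarrow> C (j - 1)\<close>, in degrees
  \<open>\<ge> 0\<close>, whose lowest term sits in degree \<open>max 0 e\<close>. If \<open>d < 0\<close> this part is empty, and its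
  convolution is the zero object. For \<open>e > 0\<close>, filling the degrees below \<open>e\<close> with zeros instead
  would only replace \<open>Y\<close> by a shift of \<open>Y\<close>.
\<close>

definition nonneg_convolution ::
  "('o, 'm, 'k, 'z) tcat_scheme \<Rightarrow> int \<Rightarrow> int \<Rightarrow> (int \<Rightarrow> 'o) \<Rightarrow> (int \<Rightarrow> 'm) \<Rightarrow> 'o \<Rightarrow> bool" where
  "nonneg_convolution T d e C \<delta> Y \<longleftrightarrow>
     (if d < 0 then zero_object T Y
      else is_convolution T (nat (d - max 0 e))
             (\<lambda>i. C (max 0 e + int i)) (\<lambda>i. \<delta> (max 0 e + int i + 1)) Y)"

definition P_stable ::
  "('k, 'r) ring_scheme \<Rightarrow> ('o, 'm, 'k, 'z) tcat_scheme \<Rightarrow> int \<Rightarrow> int \<Rightarrow>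
   (int \<Rightarrow> 'o) \<Rightarrow> (int \<Rightarrow> int \<Rightarrow> nat) \<Rightarrow> 'o \<Rightarrow> bool" where
  "P_stable k T d e C N A \<longleftrightarrow>
     (\<forall>j \<in> {e..d}. \<forall>i. hom_dim k T i (C j) A = enat (N i j)) \<and>
     (\<exists>\<delta> Y. nonneg_convolution T d e C \<delta> Y \<and>
        carrier (Hom_star T A Y) = {\<zero>\<^bsub>Hom_star T A Y\<^esub>})"

end

theory Submission
  imports Defs
begin

text \<open>
  An exact functor commutes with shifts up to natural isomorphism, and post-composition with an
  isomorphism is a linear bijection of hom-spaces. Full faithfulness therefore yields linear
  bijections \<open>Hom(a, b[i]) \<cong> Hom(\<Phi> a, y[i])\<close> whenever \<open>y \<cong> \<Phi> b\<close>
  (\<open>Hom_deg_linear_bij\<close>). These preserve dimensions, which settles condition (i), and they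
  preserve vanishing, so condition (iii) for a convolution \<open>Y\<close> of \<open>C\<close> is equivalent to
  condition (iii) for any object isomorphic to \<open>\<Phi> Y\<close>.

  It remains to compare convolutions. The image of a Postnikov system is a Postnikov system
  (\<open>convolution_image\<close>). Conversely, every convolution of a complex on the objects \<open>\<Phi> (C j)\<close>
  is isomorphic to the image of a convolution in the source category (\<open>lift_convolution\<close>):
  the differentials lift because \<open>\<Phi>\<close> is full, they still compose to zero because \<open>\<Phi>\<close> is
  faithful, and a Postnikov system is lifted one triangle at a time. Once \<open>X (i + 1)\<close> has been
  lifted, the map \<open>X (i + 1) \<rightarrow> A i\<close> lifts as well; its cone is the lift of \<open>X i\<close>, since cones of
  isomorphic maps are isomorphic (\<open>triangle_morphism_iso\<close>). The image of the lifted cone is in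
  general only isomorphic to the given \<open>X i\<close>, so the chosen isomorphisms have to be carried
  along, together with their compatibility with the maps \<open>A i \<rightarrow> X i\<close> that enter the next
  differential.
\<close>

section \<open>Linear bijections\<close>

lemma linear_map_comp:
  assumes "linear_map k U V f" "linear_map k V W g"
  shows "linear_map k U W (\<lambda>x. g (f x))"
proof -
  interpret f: linear_map k U V f by fact
  interpret g: linear_map k V W g by fact
  show ?thesis
    by (intro linear_map.intro mod_hom.intro mod_hom_axioms.intro
        f.V.vectorspace_axioms g.W.vectorspace_axioms f.V.module.module_axioms g.W.module.module_axioms)
      (auto simp: LinearCombinations.module_hom_def)
qed

lemma linear_map_inverse:
  assumes f: "linear_map k V W f" and bij: "bij_betw f (carrier V) (carrier W)"
  shows "linear_map k W V (the_inv_into (carrier V) f)"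
proof -
  interpret f: linear_map k V W f by fact
  let ?g = "the_inv_into (carrier V) f"
  have inj: "inj_on f (carrier V)" and surj: "f ` carrier V = carrier W"
    using bij by (auto simp: bij_betw_def)
  have g: "?g y \<in> carrier V" "f (?g y) = y" if "y \<in> carrier W" for y
    using that inj surj by (auto intro: the_inv_into_into f_the_inv_into_f)
  have gf: "?g (f x) = x" if "x \<in> carrier V" for x
    using that inj by (rule the_inv_into_f_f[rotated])
  have "?g (x \<oplus>\<^bsub>W\<^esub> y) = ?g x \<oplus>\<^bsub>V\<^esub> ?g y" if "x \<in> carrier W" "y \<in> carrier W" for x y
    using gf[of "?g x \<oplus>\<^bsub>V\<^esub> ?g y"] that g by simp
  moreover have "?g (r \<odot>\<^bsub>W\<^esub> x) = r \<odot>\<^bsub>V\<^esub> ?g x" if "r \<in> carrier k" "x \<in> carrier W" for r x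
    using gf[of "r \<odot>\<^bsub>V\<^esub> ?g x"] that g by simp
  ultimately show ?thesis
    using g by (intro linear_map.intro mod_hom.intro mod_hom_axioms.intro
        f.V.vectorspace_axioms f.W.vectorspace_axioms f.V.module.module_axioms f.W.module.module_axioms)
      (auto simp: LinearCombinations.module_hom_def)
qed

lemma vs_dim_eq_of_linear_bij:
  assumes f: "linear_map k V W f" and bij: "bij_betw f (carrier V) (carrier W)"
  shows "vs_dim k V = vs_dim k W"
proof -
  let ?g = "the_inv_into (carrier V) f"
  have g: "linear_map k W V ?g" "?g ` carrier W = carrier V"
    using linear_map_inverse[OF f bij] bij_betw_the_inv_into[OF bij] by (auto simp: bij_betw_def)
  have f': "inj_on f (carrier V)" "f ` carrier V = carrier W"
    using bij by (auto simp: bij_betw_def)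
  have "vectorspace.fin_dim k V \<longleftrightarrow> vectorspace.fin_dim k W"
    using linear_map.surj_fin_dim[OF f _ f'(2)] linear_map.surj_fin_dim[OF g(1) _ g(2)] by blast
  then show ?thesis
    using linear_map.dim_eq[OF f _ f'] by (simp add: vs_dim_def)
qed

lemma trivial_iff_of_linear_bij:
  assumes f: "linear_map k V W f" and bij: "bij_betw f (carrier V) (carrier W)"
  shows "carrier V = {\<zero>\<^bsub>V\<^esub>} \<longleftrightarrow> carrier W = {\<zero>\<^bsub>W\<^esub>}"
proof -
  interpret f: linear_map k V W f by fact
  interpret g: linear_map k W V "the_inv_into (carrier V) f"
    by (rule linear_map_inverse[OF f bij])
  have "f ` carrier V = carrier W" "the_inv_into (carrier V) f ` carrier W = carrier V"
    using bij bij_betw_the_inv_into[OF bij] by (auto simp: bij_betw_def)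
  then show ?thesis
    using f.T0_is_0 g.T0_is_0 by (metis image_empty image_insert)
qed


section \<open>Isomorphisms and zero objects in linear categories\<close>

context linear_category
begin

lemma Hom_abelian_group: "a \<in> Obj C \<Longrightarrow> b \<in> Obj C \<Longrightarrow> abelian_group (Hom C a b)"
  using Hom_vectorspace[of a b] by (auto simp: vectorspace_def intro: module.axioms(2))

lemma Zero_closed: "a \<in> Obj C \<Longrightarrow> b \<in> Obj C \<Longrightarrow> Zero C a b \<in> Mor C a b"
  using Hom_abelian_group[of a b] by (simp add: abelian_group.axioms abelian_monoid.zero_closed)

lemma Comp_closed:
  assumes "a \<in> Obj C" "b \<in> Obj C" "c \<in> Obj C" "f \<in> Mor C a b" "g \<in> Mor C b c"
  shows "g \<bullet>\<^bsub>C\<^esub> f \<in> Mor C a c"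
  using linear_map.T_im[OF Comp_linear_left[OF assms(1-4)] assms(5)] .

lemma Zero_Comp:
  assumes "a \<in> Obj C" "b \<in> Obj C" "c \<in> Obj C" "f \<in> Mor C a b"
  shows "Zero C b c \<bullet>\<^bsub>C\<^esub> f = Zero C a c"
  using linear_map.T0_is_0[OF Comp_linear_left[OF assms]] .

lemma Comp_Zero:
  assumes "a \<in> Obj C" "b \<in> Obj C" "c \<in> Obj C" "g \<in> Mor C b c"
  shows "g \<bullet>\<^bsub>C\<^esub> Zero C a b = Zero C a c"
  using linear_map.T0_is_0[OF Comp_linear_right[OF assms]] .

lemma zero_object_iff:
  assumes z: "z \<in> Obj C"
  shows "zero_object C z \<longleftrightarrow> Id C z = Zero C z z"
proof
  assume "zero_object C z"
  then show "Id C z = Zero C z z"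
    using z Id_closed[OF z] Zero_closed[OF z z] unfolding zero_object_def by metis
next
  assume Id: "Id C z = Zero C z z"
  have "f = Zero C a z" if "a \<in> Obj C" "f \<in> Mor C a z" for a f
    using Id_left[OF that(1) z that(2)] Zero_Comp[OF that(1) z z that(2)] Id by simp
  moreover have "f = Zero C z a" if "a \<in> Obj C" "f \<in> Mor C z a" for a f
    using Id_right[OF z that] Comp_Zero[OF z z that] Id by simp
  ultimately show "zero_object C z"
    unfolding zero_object_def using z Zero_closed by metis
qed

lemma is_iso_Id: "a \<in> Obj C \<Longrightarrow> is_iso C a a (Id C a)"
  unfolding is_iso_def using Id_closed Id_left by blast

lemma is_iso_Comp:
  assumes ob: "a \<in> Obj C" "b \<in> Obj C" "c \<in> Obj C" and f: "is_iso C a b f" and g: "is_iso C b c g"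
  shows "is_iso C a c (g \<bullet>\<^bsub>C\<^esub> f)"
proof -
  obtain f' where f': "f' \<in> Mor C b a" "f' \<bullet>\<^bsub>C\<^esub> f = Id C a" "f \<bullet>\<^bsub>C\<^esub> f' = Id C b"
    and fm: "f \<in> Mor C a b" using f unfolding is_iso_def by blast
  obtain g' where g': "g' \<in> Mor C c b" "g' \<bullet>\<^bsub>C\<^esub> g = Id C b" "g \<bullet>\<^bsub>C\<^esub> g' = Id C c"
    and gm: "g \<in> Mor C b c" using g unfolding is_iso_def by blast
  have gf: "g \<bullet>\<^bsub>C\<^esub> f \<in> Mor C a c" and fg: "f' \<bullet>\<^bsub>C\<^esub> g' \<in> Mor C c a"
    using Comp_closed ob fm gm f' g' by blast+
  have "(f' \<bullet>\<^bsub>C\<^esub> g') \<bullet>\<^bsub>C\<^esub> (g \<bullet>\<^bsub>C\<^esub> f) = f' \<bullet>\<^bsub>C\<^esub> ((g' \<bullet>\<^bsub>C\<^esub> g) \<bullet>\<^bsub>C\<^esub> f)"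
    using Comp_assoc[OF ob(1,3,2,1) gf g'(1) f'(1)] Comp_assoc[OF ob(1,2,3,2) fm gm g'(1)] by simp
  moreover have "(g \<bullet>\<^bsub>C\<^esub> f) \<bullet>\<^bsub>C\<^esub> (f' \<bullet>\<^bsub>C\<^esub> g') = g \<bullet>\<^bsub>C\<^esub> ((f \<bullet>\<^bsub>C\<^esub> f') \<bullet>\<^bsub>C\<^esub> g')"
    using Comp_assoc[OF ob(3,1,2,3) fg fm gm] Comp_assoc[OF ob(3,2,1,2) g'(1) f'(1) fm] by simp
  ultimately show ?thesis
    unfolding is_iso_def using gf fg f' g' fm gm Id_left ob by metis
qed

lemma is_iso_of_one_sided_inverses:
  assumes ob: "a \<in> Obj C" "b \<in> Obj C" and f: "f \<in> Mor C a b"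
    and l: "l \<in> Mor C b a" "l \<bullet>\<^bsub>C\<^esub> f = Id C a" and r: "r \<in> Mor C b a" "f \<bullet>\<^bsub>C\<^esub> r = Id C b"
  shows "is_iso C a b f"
proof -
  have "l = (l \<bullet>\<^bsub>C\<^esub> f) \<bullet>\<^bsub>C\<^esub> r"
    using Comp_assoc[OF ob(2,1,2,1) r(1) f l(1)] r Id_right[OF ob(2,1) l(1)] by simp
  then have "l = r" using l Id_left[OF ob(2,1) r(1)] by simp
  then show ?thesis unfolding is_iso_def using f l r by blast
qed

text \<open>If \<open>w = 1 + n\<close> with \<open>n\<close> of square zero, then \<open>1 - n\<close> is inverse to \<open>w\<close>.\<close>

lemma is_iso_unipotent:
  assumes c: "c \<in> Obj C" and w: "w \<in> Mor C c c"
    and sq: "(w \<ominus>\<^bsub>Hom C c c\<^esub> Id C c) \<bullet>\<^bsub>C\<^esub> (w \<ominus>\<^bsub>Hom C c c\<^esub> Id C c) = Zero C c c"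
  shows "is_iso C c c w"
proof -
  let ?H = "Hom C c c"
  interpret H: abelian_group ?H by (rule Hom_abelian_group[OF c c])
  define n where "n = w \<ominus>\<^bsub>?H\<^esub> Id C c"
  define v where "v = Id C c \<ominus>\<^bsub>?H\<^esub> n"
  have I: "Id C c \<in> Mor C c c" using c by (rule Id_closed)
  have n: "n \<in> Mor C c c" and v: "v \<in> Mor C c c"
    using w I by (auto simp: n_def v_def)
  have nn: "n \<bullet>\<^bsub>C\<^esub> n = Zero C c c" using sq by (simp add: n_def)
  have w_eq: "w = n \<oplus>\<^bsub>?H\<^esub> Id C c"
    using w I by (simp add: n_def H.minus_eq H.a_assoc H.l_neg)
  have vn: "v \<bullet>\<^bsub>C\<^esub> n = n"
    using linear_map.T_minus[OF Comp_linear_left[OF c c c n] I n] nn n Id_left[OF c c n]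
    by (simp add: v_def H.minus_eq)
  have nv: "n \<bullet>\<^bsub>C\<^esub> v = n"
    using linear_map.T_minus[OF Comp_linear_right[OF c c c n] I n] nn n Id_right[OF c c n]
    by (simp add: v_def H.minus_eq)
  have sum: "n \<oplus>\<^bsub>?H\<^esub> v = Id C c"
    using n I by (simp add: v_def H.minus_eq H.a_comm[of n] H.a_assoc H.l_neg)
  have "v \<bullet>\<^bsub>C\<^esub> w = Id C c"
    using linear_map.T_add[OF Comp_linear_right[OF c c c v] n I] vn sum Id_right[OF c c v]
    by (simp add: w_eq)
  moreover have "w \<bullet>\<^bsub>C\<^esub> v = Id C c"
    using linear_map.T_add[OF Comp_linear_left[OF c c c v] n I] nv sum Id_left[OF c c v]
    by (simp add: w_eq)
  ultimately show ?thesis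
    unfolding is_iso_def using w v by blast
qed

end

definition iso_objects :: "('o, 'm, 'k, 'z) lcat_scheme \<Rightarrow> 'o \<Rightarrow> 'o \<Rightarrow> bool" where
  "iso_objects C a b \<longleftrightarrow> a \<in> Obj C \<and> b \<in> Obj C \<and> (\<exists>f. is_iso C a b f)"

context linear_category
begin

lemma iso_objects_refl: "a \<in> Obj C \<Longrightarrow> iso_objects C a a"
  using is_iso_Id by (auto simp: iso_objects_def)

lemma iso_objects_sym: "iso_objects C a b \<Longrightarrow> iso_objects C b a"
  by (auto simp: iso_objects_def is_iso_def)

lemma iso_objects_trans [trans]: "iso_objects C a b \<Longrightarrow> iso_objects C b c \<Longrightarrow> iso_objects C a c"
  using is_iso_Comp unfolding iso_objects_def by blast

lemma zero_objects_iso: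
  assumes "zero_object C y" "zero_object C z"
  shows "iso_objects C y z"
proof -
  have ob: "y \<in> Obj C" "z \<in> Obj C" using assms by (auto simp: zero_object_def)
  then have "Zero C z y \<bullet>\<^bsub>C\<^esub> Zero C y z = Id C y" "Zero C y z \<bullet>\<^bsub>C\<^esub> Zero C z y = Id C z"
    using assms zero_object_iff Zero_Comp Zero_closed by metis+
  then show ?thesis
    unfolding iso_objects_def is_iso_def using ob Zero_closed by blast
qed

lemma bij_betw_Comp_iso:
  assumes ob: "a \<in> Obj C" "b \<in> Obj C" "c \<in> Obj C" and f: "is_iso C b c f"
  shows "bij_betw (\<lambda>x. f \<bullet>\<^bsub>C\<^esub> x) (Mor C a b) (Mor C a c)"
proof -
  obtain g where g: "g \<in> Mor C c b" "g \<bullet>\<^bsub>C\<^esub> f = Id C b" "f \<bullet>\<^bsub>C\<^esub> g = Id C c"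
    and fm: "f \<in> Mor C b c" using f unfolding is_iso_def by blast
  show ?thesis
  proof (rule bij_betwI[where g = "\<lambda>x. g \<bullet>\<^bsub>C\<^esub> x"])
    show "g \<bullet>\<^bsub>C\<^esub> f \<bullet>\<^bsub>C\<^esub> x = x" if "x \<in> Mor C a b" for x
      using Comp_assoc[OF ob(1,2,3,2) that fm g(1)] g Id_left[OF ob(1,2) that] by simp
    show "f \<bullet>\<^bsub>C\<^esub> g \<bullet>\<^bsub>C\<^esub> x = x" if "x \<in> Mor C a c" for x
      using Comp_assoc[OF ob(1,3,2,3) that g(1) fm] g Id_left[OF ob(1,3) that] by simp
  qed (use Comp_closed ob fm g in blast)+
qed

end

context linear_functor
begin

lemma mmap_closed: "a \<in> Obj C \<Longrightarrow> b \<in> Obj C \<Longrightarrow> f \<in> Mor C a b \<Longrightarrow> mmap F f \<in> Mor D (omap F a) (omap F b)"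
  using linear_map.T_im[OF mmap_linear] .

lemma mmap_Zero: "a \<in> Obj C \<Longrightarrow> b \<in> Obj C \<Longrightarrow> mmap F (Zero C a b) = Zero D (omap F a) (omap F b)"
  using linear_map.T0_is_0[OF mmap_linear] .

lemma mmap_iso:
  assumes ob: "a \<in> Obj C" "b \<in> Obj C" and f: "is_iso C a b f"
  shows "is_iso D (omap F a) (omap F b) (mmap F f)"
proof -
  obtain g where g: "g \<in> Mor C b a" "g \<bullet>\<^bsub>C\<^esub> f = Id C a" "f \<bullet>\<^bsub>C\<^esub> g = Id C b"
    and fm: "f \<in> Mor C a b" using f unfolding is_iso_def by blast
  have "mmap F g \<bullet>\<^bsub>D\<^esub> mmap F f = Id D (omap F a)" "mmap F f \<bullet>\<^bsub>D\<^esub> mmap F g = Id D (omap F b)"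
    using mmap_Comp[OF ob(1,2,1) fm g(1)] mmap_Comp[OF ob(2,1,2) g(1) fm] g mmap_Id ob by simp_all
  then show ?thesis
    unfolding is_iso_def using mmap_closed ob fm g(1) by blast
qed

lemma omap_iso_objects: "iso_objects C a b \<Longrightarrow> iso_objects D (omap F a) (omap F b)"
  using mmap_iso omap_closed unfolding iso_objects_def by blast

lemma omap_zero_object: "zero_object C z \<Longrightarrow> zero_object D (omap F z)"
  by (metis Cod.zero_object_iff Dom.zero_object_iff mmap_Id mmap_Zero omap_closed zero_object_def)

end


section \<open>Isomorphisms of distinguished triangles\<close>

context triangulated_category
begin

sublocale Shift: linear_functor k T T "Shift T"
  by (rule Shift_functor)

sublocale Unshift: linear_functor k T T "Unshift T"
  by (rule Unshift_functor)

lemma Tri_closed: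
  assumes "(a, b, c, f, g, h) \<in> Tri T"
  shows "a \<in> Obj T" "b \<in> Obj T" "c \<in> Obj T" "f \<in> Mor T a b" "g \<in> Mor T b c"
    "h \<in> Mor T c (sho T a)" "sho T a \<in> Obj T"
  using Tri_triangle[OF assms] Shift.omap_closed by (auto simp: is_triangle_def)

text \<open>For a zero object \<open>z\<close>, this is the rotation of the triangle \<open>c \<rightarrow> c \<rightarrow> z[1]\<close> on the identity.\<close>

lemma zero_source_triangle:
  assumes c: "c \<in> Obj T" and z: "zero_object T z"
  shows "(z, c, c, Zero T z c, Id T c, Zero T c (sho T z)) \<in> Tri T"
proof -
  have zo: "z \<in> Obj T" "zero_object T (sho T z)" "sho T z \<in> Obj T" "sho T c \<in> Obj T"
    using z c Shift.omap_zero_object Shift.omap_closed by (auto simp: zero_object_def)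
  interpret H: abelian_group "Hom T (sho T z) (sho T c)"
    by (rule Hom_abelian_group[OF zo(3,4)])
  have "\<ominus>\<^bsub>Hom T (sho T z) (sho T c)\<^esub> shm T (Zero T z c) = Zero T (sho T z) (sho T c)"
    using Shift.mmap_Zero[OF zo(1) c] H.minus_equality[of "Zero T (sho T z) (sho T c)" "Zero T (sho T z) (sho T c)"]
    by simp
  moreover have "(c, c, sho T z, Id T c, Zero T c (sho T z), Zero T (sho T z) (sho T c)) \<in> Tri T"
    by (rule TR1_id[OF c zo(2)])
  moreover have "is_triangle T (z, c, c, Zero T z c, Id T c, Zero T c (sho T z))"
    using zo c Zero_closed Id_closed by (simp add: is_triangle_def)
  ultimately show ?thesis
    using TR2 by simp
qed

text \<open>
  A map that vanishes on \<open>b\<close> is the middle component of a morphism, given on \<open>b\<close> by the zero map,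
  from the rotated triangle \<open>b \<rightarrow> c \<rightarrow> a[1]\<close> to the triangle \<open>0 \<rightarrow> x \<rightarrow> x\<close>. The third component,
  which axiom TR3 provides, is the factorization.
\<close>

lemma weak_cokernel:
  assumes tri: "(a, b, c, f, g, h) \<in> Tri T" and x: "x \<in> Obj T"
    and n: "n \<in> Mor T c x" "n \<bullet>\<^bsub>T\<^esub> g = Zero T b x"
  obtains t where "t \<in> Mor T (sho T a) x" "t \<bullet>\<^bsub>T\<^esub> h = n"
proof -
  obtain z where z: "zero_object T z" using zero_object_exists by blast
  then have zo: "z \<in> Obj T" by (simp add: zero_object_def)
  note cl = Tri_closed[OF tri]
  have rot: "(b, c, sho T a, g, h, \<ominus>\<^bsub>Hom T (sho T a) (sho T b)\<^esub> shm T f) \<in> Tri T"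
    using TR2[OF Tri_triangle[OF tri]] tri by simp
  have "n \<bullet>\<^bsub>T\<^esub> g = Zero T z x \<bullet>\<^bsub>T\<^esub> Zero T b z"
    using n(2) Zero_Comp[OF cl(2) zo x Zero_closed[OF cl(2) zo]] by simp
  then obtain t where
    "triangle_morphism T (b, c, sho T a, g, h, \<ominus>\<^bsub>Hom T (sho T a) (sho T b)\<^esub> shm T f)
       (z, x, x, Zero T z x, Id T x, Zero T x (sho T z)) (Zero T b z) n t"
    using TR3[OF rot zero_source_triangle[OF x z] Zero_closed[OF cl(2) zo] n(1)] by blast
  then have "t \<in> Mor T (sho T a) x" "t \<bullet>\<^bsub>T\<^esub> h = n"
    using Id_left[OF cl(3) x n(1)] by (simp_all add: triangle_morphism_def)
  then show ?thesis by (rule that)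
qed

text \<open>
  This replaces the five lemma, and with it the long exact sequences. The map \<open>n = w - 1\<close>
  satisfies \<open>n \<bullet> g = 0\<close> and \<open>h \<bullet> n = 0\<close>. By the first equation it factors as \<open>n = t \<bullet> h\<close>, so by the
  second \<open>n \<bullet> n = t \<bullet> h \<bullet> n = 0\<close>.
\<close>

lemma triangle_endomorphism_iso:
  assumes tri: "(a, b, c, f, g, h) \<in> Tri T"
    and w: "w \<in> Mor T c c" "w \<bullet>\<^bsub>T\<^esub> g = g" "h \<bullet>\<^bsub>T\<^esub> w = h"
  shows "is_iso T c c w"
proof (rule is_iso_unipotent)
  note cl = Tri_closed[OF tri]
  let ?n = "w \<ominus>\<^bsub>Hom T c c\<^esub> Id T c"
  interpret cc: abelian_group "Hom T c c" by (rule Hom_abelian_group[OF cl(3,3)])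
  interpret bc: abelian_group "Hom T b c" by (rule Hom_abelian_group[OF cl(2,3)])
  interpret ca: abelian_group "Hom T c (sho T a)" by (rule Hom_abelian_group[OF cl(3,7)])
  have I: "Id T c \<in> Mor T c c" using cl by (simp add: Id_closed)
  have n: "?n \<in> Mor T c c" using w I by simp
  have "?n \<bullet>\<^bsub>T\<^esub> g = Zero T b c"
    using linear_map.T_minus[OF Comp_linear_left[OF cl(2,3,3,5)] w(1) I] w Id_left[OF cl(2,3,5)] cl
    by (simp add: bc.minus_eq bc.r_neg)
  moreover have hn: "h \<bullet>\<^bsub>T\<^esub> ?n = Zero T c (sho T a)"
    using linear_map.T_minus[OF Comp_linear_right[OF cl(3,3,7,6)] w(1) I] w Id_right[OF cl(3,7,6)] cl
    by (simp add: ca.minus_eq ca.r_neg)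
  ultimately obtain t where t: "t \<in> Mor T (sho T a) c" "t \<bullet>\<^bsub>T\<^esub> h = ?n"
    using weak_cokernel[OF tri cl(3) n] by blast
  show "?n \<bullet>\<^bsub>T\<^esub> ?n = Zero T c c"
    using Comp_assoc[OF cl(3,3,7,3) n cl(6) t(1)] t(2) hn Comp_Zero[OF cl(3,7,3) t(1)] by simp
qed (use w Tri_closed[OF tri] in auto)

text \<open>
  The inverses of \<open>u\<close> and \<open>v\<close> extend to a morphism \<open>(u', v', w')\<close> of triangles in the other
  direction. There is no reason for \<open>w'\<close> to be inverse to \<open>w\<close>, but both composites of \<open>w\<close> and \<open>w'\<close>
  are compatible with identities on the other two vertices, hence are isomorphisms. So \<open>w\<close> has
  a left and a right inverse.
\<close>

lemma triangle_morphism_iso: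
  assumes tri: "(a, b, c, f, g, h) \<in> Tri T" and tri': "(a', b', c', f', g', h') \<in> Tri T"
    and mor: "triangle_morphism T (a, b, c, f, g, h) (a', b', c', f', g', h') u v w"
    and u: "is_iso T a a' u" and v: "is_iso T b b' v"
  shows "is_iso T c c' w"
proof -
  note cl = Tri_closed[OF tri] and cl' = Tri_closed[OF tri']
  obtain u' where u': "u' \<in> Mor T a' a" "u' \<bullet>\<^bsub>T\<^esub> u = Id T a" "u \<bullet>\<^bsub>T\<^esub> u' = Id T a'"
    using u unfolding is_iso_def by blast
  obtain v' where v': "v' \<in> Mor T b' b" "v' \<bullet>\<^bsub>T\<^esub> v = Id T b" "v \<bullet>\<^bsub>T\<^esub> v' = Id T b'"
    using v unfolding is_iso_def by blast
  have m: "u \<in> Mor T a a'" "v \<in> Mor T b b'" "w \<in> Mor T c c'" "v \<bullet>\<^bsub>T\<^esub> f = f' \<bullet>\<^bsub>T\<^esub> u"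
    "w \<bullet>\<^bsub>T\<^esub> g = g' \<bullet>\<^bsub>T\<^esub> v" "shm T u \<bullet>\<^bsub>T\<^esub> h = h' \<bullet>\<^bsub>T\<^esub> w"
    using mor by (auto simp: triangle_morphism_def)
  \<comment> \<open>the commutative square needed to extend \<open>u'\<close> and \<open>v'\<close>\<close>
  have "v' \<bullet>\<^bsub>T\<^esub> f' = v' \<bullet>\<^bsub>T\<^esub> (f' \<bullet>\<^bsub>T\<^esub> u) \<bullet>\<^bsub>T\<^esub> u'"
    using Comp_assoc[OF cl'(1) cl(1) cl'(1,2) u'(1) m(1) cl'(4)] u'(3) Id_right[OF cl'(1,2,4)] by simp
  also have "\<dots> = v' \<bullet>\<^bsub>T\<^esub> v \<bullet>\<^bsub>T\<^esub> f \<bullet>\<^bsub>T\<^esub> u'"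
    using m(4) Comp_assoc[OF cl'(1) cl(1,2) cl'(2) u'(1) cl(4) m(2)] by simp
  also have "\<dots> = f \<bullet>\<^bsub>T\<^esub> u'"
    using Comp_assoc[OF cl'(1) cl(2) cl'(2) cl(2) Comp_closed[OF cl'(1) cl(1,2) u'(1) cl(4)] m(2) v'(1)]
      v'(2) Id_left[OF cl'(1) cl(2) Comp_closed[OF cl'(1) cl(1,2) u'(1) cl(4)]] by simp
  finally obtain w' where
    "triangle_morphism T (a', b', c', f', g', h') (a, b, c, f, g, h) u' v' w'"
    using TR3[OF tri' tri u'(1) v'(1)] by blast
  then have m': "w' \<in> Mor T c' c" "w' \<bullet>\<^bsub>T\<^esub> g' = g \<bullet>\<^bsub>T\<^esub> v'" "shm T u' \<bullet>\<^bsub>T\<^esub> h' = h \<bullet>\<^bsub>T\<^esub> w'"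
    by (auto simp: triangle_morphism_def)
  have sh: "shm T u \<in> Mor T (sho T a) (sho T a')" "shm T u' \<in> Mor T (sho T a') (sho T a)"
    "shm T u' \<bullet>\<^bsub>T\<^esub> shm T u = Id T (sho T a)" "shm T u \<bullet>\<^bsub>T\<^esub> shm T u' = Id T (sho T a')"
    using Shift.mmap_closed Shift.mmap_Comp Shift.mmap_Id cl(1) cl'(1) m(1) u' by metis+
  have cw: "w' \<bullet>\<^bsub>T\<^esub> w \<in> Mor T c c" "w \<bullet>\<^bsub>T\<^esub> w' \<in> Mor T c' c'"
    using Comp_closed cl(3) cl'(3) m(3) m'(1) by blast+
  have "is_iso T c c (w' \<bullet>\<^bsub>T\<^esub> w)"
  proof (rule triangle_endomorphism_iso[OF tri cw(1)])
    have "(w' \<bullet>\<^bsub>T\<^esub> w) \<bullet>\<^bsub>T\<^esub> g = w' \<bullet>\<^bsub>T\<^esub> (g' \<bullet>\<^bsub>T\<^esub> v)"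
      using Comp_assoc[OF cl(2,3) cl'(3) cl(3) cl(5) m(3) m'(1)] m(5) by simp
    also have "\<dots> = (g \<bullet>\<^bsub>T\<^esub> v') \<bullet>\<^bsub>T\<^esub> v"
      using Comp_assoc[OF cl(2) cl'(2,3) cl(3) m(2) cl'(5) m'(1)] m'(2) by simp
    finally show "(w' \<bullet>\<^bsub>T\<^esub> w) \<bullet>\<^bsub>T\<^esub> g = g"
      using Comp_assoc[OF cl(2) cl'(2) cl(2,3) m(2) v'(1) cl(5)] v'(2) Id_right[OF cl(2,3,5)] by simp
    have "h \<bullet>\<^bsub>T\<^esub> w' \<bullet>\<^bsub>T\<^esub> w = shm T u' \<bullet>\<^bsub>T\<^esub> h' \<bullet>\<^bsub>T\<^esub> w"
      using Comp_assoc[OF cl(3) cl'(3) cl(3,7) m(3) m'(1) cl(6)]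
        Comp_assoc[OF cl(3) cl'(3,7) cl(7) m(3) cl'(6) sh(2)] m'(3) by simp
    then show "h \<bullet>\<^bsub>T\<^esub> w' \<bullet>\<^bsub>T\<^esub> w = h"
      using Comp_assoc[OF cl(3,7) cl'(7) cl(7) cl(6) sh(1,2)] m(6) sh(3) Id_left[OF cl(3,7,6)] by simp
  qed
  moreover have "is_iso T c' c' (w \<bullet>\<^bsub>T\<^esub> w')"
  proof (rule triangle_endomorphism_iso[OF tri' cw(2)])
    have "(w \<bullet>\<^bsub>T\<^esub> w') \<bullet>\<^bsub>T\<^esub> g' = w \<bullet>\<^bsub>T\<^esub> (g \<bullet>\<^bsub>T\<^esub> v')"
      using Comp_assoc[OF cl'(2,3) cl(3) cl'(3) cl'(5) m'(1) m(3)] m'(2) by simp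
    also have "\<dots> = (g' \<bullet>\<^bsub>T\<^esub> v) \<bullet>\<^bsub>T\<^esub> v'"
      using Comp_assoc[OF cl'(2) cl(2,3) cl'(3) v'(1) cl(5) m(3)] m(5) by simp
    finally show "(w \<bullet>\<^bsub>T\<^esub> w') \<bullet>\<^bsub>T\<^esub> g' = g'"
      using Comp_assoc[OF cl'(2) cl(2) cl'(2,3) v'(1) m(2) cl'(5)] v'(3) Id_right[OF cl'(2,3,5)] by simp
    have "h' \<bullet>\<^bsub>T\<^esub> w \<bullet>\<^bsub>T\<^esub> w' = shm T u \<bullet>\<^bsub>T\<^esub> h \<bullet>\<^bsub>T\<^esub> w'"
      using Comp_assoc[OF cl'(3) cl(3) cl'(3,7) m'(1) m(3) cl'(6)]
        Comp_assoc[OF cl'(3) cl(3,7) cl'(7) m'(1) cl(6) sh(1)] m(6) by simp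
    then show "h' \<bullet>\<^bsub>T\<^esub> w \<bullet>\<^bsub>T\<^esub> w' = h'"
      using Comp_assoc[OF cl'(3,7) cl(7) cl'(7) cl'(6) sh(2,1)] m'(3) sh(4) Id_left[OF cl'(3,7,6)] by simp
  qed
  ultimately obtain l r where
    l: "l \<in> Mor T c c" "l \<bullet>\<^bsub>T\<^esub> w' \<bullet>\<^bsub>T\<^esub> w = Id T c" and
    r: "r \<in> Mor T c' c'" "(w \<bullet>\<^bsub>T\<^esub> w') \<bullet>\<^bsub>T\<^esub> r = Id T c'"
    unfolding is_iso_def by blast
  show ?thesis
  proof (rule is_iso_of_one_sided_inverses[OF cl(3) cl'(3) m(3)])
    show "l \<bullet>\<^bsub>T\<^esub> w' \<in> Mor T c' c" "w' \<bullet>\<^bsub>T\<^esub> r \<in> Mor T c' c"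
      using Comp_closed cl(3) cl'(3) l r m'(1) by blast+
    show "(l \<bullet>\<^bsub>T\<^esub> w') \<bullet>\<^bsub>T\<^esub> w = Id T c"
      using Comp_assoc[OF cl(3) cl'(3) cl(3,3) m(3) m'(1) l(1)] l(2) by simp
    show "w \<bullet>\<^bsub>T\<^esub> w' \<bullet>\<^bsub>T\<^esub> r = Id T c'"
      using Comp_assoc[OF cl'(3,3) cl(3) cl'(3) r(1) m'(1) m(3)] r(2) by simp
  qed
qed

end


section \<open>Exact functors and shifts\<close>

lemma (in triangulated_category) shift_obj_closed: "a \<in> Obj T \<Longrightarrow> shift_obj T i a \<in> Obj T"
proof -
  assume a: "a \<in> Obj T"
  have "(omap (Shift T) ^^ n) a \<in> Obj T" "(omap (Unshift T) ^^ n) a \<in> Obj T" for n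
    using a by (induction n) (simp_all add: Shift.omap_closed Unshift.omap_closed)
  then show ?thesis by (simp add: shift_obj_def)
qed

lemma (in triangulated_category) iso_objects_shift_obj:
  assumes "iso_objects T a b"
  shows "iso_objects T (shift_obj T i a) (shift_obj T i b)"
proof -
  have "iso_objects T ((omap (Shift T) ^^ n) a) ((omap (Shift T) ^^ n) b)"
    "iso_objects T ((omap (Unshift T) ^^ n) a) ((omap (Unshift T) ^^ n) b)" for n
    using assms by (induction n) (simp_all add: Shift.omap_iso_objects Unshift.omap_iso_objects)
  then show ?thesis by (simp add: shift_obj_def)
qed

lemma (in triangulated_category) Unshift_Shift_iso:
  assumes "a \<in> Obj T" shows "iso_objects T a (omap (Unshift T) (sho T a))"
  using Unshift_Shift assms Shift.omap_closed Unshift.omap_closed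
  unfolding natural_iso_def comp_fdata_def id_fdata_def iso_objects_def by auto

lemma (in triangulated_category) Shift_Unshift_iso:
  assumes "a \<in> Obj T" shows "iso_objects T (sho T (omap (Unshift T) a)) a"
  using Shift_Unshift assms Shift.omap_closed Unshift.omap_closed
  unfolding natural_iso_def comp_fdata_def id_fdata_def iso_objects_def by auto

context exact_functor
begin

lemma Shift_iso: "a \<in> Obj T \<Longrightarrow> iso_objects S (omap \<Phi> (sho T a)) (sho S (omap \<Phi> a))"
  using exact omap_closed Dom.Shift.omap_closed Cod.Shift.omap_closed
  unfolding natural_iso_def comp_fdata_def iso_objects_def by auto

text \<open>
  Exactness only provides a comparison with the positive shift. Writing \<open>U\<close> for the inverse shift,
  the comparison for \<open>U\<close> is the composite \<open>\<Phi> (U a) \<cong> U ((\<Phi> (U a))[1]) \<cong> U (\<Phi> ((U a)[1])) \<cong> U (\<Phi> a)\<close>.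
\<close>

lemma Unshift_iso:
  assumes a: "a \<in> Obj T"
  shows "iso_objects S (omap \<Phi> (omap (Unshift T) a)) (omap (Unshift S) (omap \<Phi> a))"
proof -
  let ?u = "omap (Unshift T) a"
  have u: "?u \<in> Obj T" using a by (rule Dom.Unshift.omap_closed)
  have "iso_objects S (omap \<Phi> ?u) (omap (Unshift S) (sho S (omap \<Phi> ?u)))"
    using Cod.Unshift_Shift_iso omap_closed u by blast
  also have "iso_objects S \<dots> (omap (Unshift S) (omap \<Phi> (sho T ?u)))"
    using Shift_iso[OF u] Cod.iso_objects_sym Cod.Unshift.omap_iso_objects by blast
  also have "iso_objects S \<dots> (omap (Unshift S) (omap \<Phi> a))"
    using Dom.Shift_Unshift_iso[OF a] omap_iso_objects Cod.Unshift.omap_iso_objects by blast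
  finally show ?thesis .
qed

lemma shift_obj_iso:
  assumes a: "a \<in> Obj T"
  shows "iso_objects S (omap \<Phi> (shift_obj T i a)) (shift_obj S i (omap \<Phi> a))"
proof -
  have "(omap (Shift T) ^^ n) a \<in> Obj T \<and>
    iso_objects S (omap \<Phi> ((omap (Shift T) ^^ n) a)) ((omap (Shift S) ^^ n) (omap \<Phi> a))" for n
  proof (induction n)
    case 0
    then show ?case using a omap_closed Cod.iso_objects_refl by simp
  next
    case (Suc n)
    then show ?case
      using Cod.iso_objects_trans[OF Shift_iso Cod.Shift.omap_iso_objects] Dom.Shift.omap_closed
      by simp
  qed
  moreover have "(omap (Unshift T) ^^ n) a \<in> Obj T \<and>
    iso_objects S (omap \<Phi> ((omap (Unshift T) ^^ n) a)) ((omap (Unshift S) ^^ n) (omap \<Phi> a))" for n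
  proof (induction n)
    case 0
    then show ?case using a omap_closed Cod.iso_objects_refl by simp
  next
    case (Suc n)
    then show ?case
      using Cod.iso_objects_trans[OF Unshift_iso Cod.Unshift.omap_iso_objects] Dom.Unshift.omap_closed
      by simp
  qed
  ultimately show ?thesis by (simp add: shift_obj_def)
qed

lemma Tri_image:
  obtains \<eta> where "\<And>a b c f g h. (a, b, c, f, g, h) \<in> Tri T \<Longrightarrow>
    (omap \<Phi> a, omap \<Phi> b, omap \<Phi> c, mmap \<Phi> f, mmap \<Phi> g, \<eta> a \<bullet>\<^bsub>S\<^esub> mmap \<Phi> h) \<in> Tri S"
  using exact by blast

end

section \<open>Complexes and convolutions under exact functors\<close>

lemma is_complex_tail:
  assumes "is_complex T (Suc n) A \<delta>"
  shows "is_complex T n (\<lambda>i. A (Suc i)) (\<lambda>i. \<delta> (Suc i))"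
proof -
  have "\<delta> (Suc i) \<bullet>\<^bsub>T\<^esub> \<delta> (Suc (i + 1)) = Zero T (A (Suc (i + 2))) (A (Suc i))" if "i + 1 < n" for i
    using assms[unfolded is_complex_def, THEN conjunct2, THEN conjunct2, rule_format, of "Suc i"] that
    by simp
  then show ?thesis using assms by (simp add: is_complex_def)
qed

text \<open>
  Splitting off the last triangle turns the descending construction of a Postnikov system into an
  ordinary induction on the length of the complex.
\<close>

lemma postnikov_system_Suc:
  "postnikov_system T (Suc n) A \<delta> X p q r \<longleftrightarrow>
     postnikov_system T n (\<lambda>i. A (Suc i)) (\<lambda>i. \<delta> (Suc i))
       (\<lambda>i. X (Suc i)) (\<lambda>i. p (Suc i)) (\<lambda>i. q (Suc i)) (\<lambda>i. r (Suc i)) \<and>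
     (X 1, A 0, X 0, p 0, q 0, r 0) \<in> Tri T \<and> \<delta> 0 = p 0 \<bullet>\<^bsub>T\<^esub> q 1"
  unfolding postnikov_system_def All_less_Suc2 by auto

lemma (in triangulated_category) postnikov_system_closed:
  assumes "postnikov_system T n A \<delta> X p q r" "i < n"
  shows "X (i + 1) \<in> Obj T" "X i \<in> Obj T" "p i \<in> Mor T (X (i + 1)) (A i)"
    "q i \<in> Mor T (A i) (X i)"
proof -
  have "(X (i + 1), A i, X i, p i, q i, r i) \<in> Tri T"
    using assms by (simp add: postnikov_system_def)
  note Tri_closed[OF this]
  then show "X (i + 1) \<in> Obj T" "X i \<in> Obj T" "p i \<in> Mor T (X (i + 1)) (A i)"
    "q i \<in> Mor T (A i) (X i)" by simp_all
qed

lemma (in triangulated_category) postnikov_system_objects: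
  assumes ps: "postnikov_system T n A \<delta> X p q r" and A: "\<forall>i\<le>n. A i \<in> Obj T" and i: "i \<le> n"
  shows "X i \<in> Obj T" "q i \<in> Mor T (A i) (X i)"
proof -
  have "X i \<in> Obj T \<and> q i \<in> Mor T (A i) (X i)"
  proof (cases "i = n")
    case True
    have "X n = A n" "q n = Id T (A n)" "A n \<in> Obj T"
      using ps A by (simp_all add: postnikov_system_def)
    then show ?thesis using True Id_closed by simp
  next
    case False
    then show ?thesis using postnikov_system_closed[OF ps, of i] i by simp
  qed
  then show "X i \<in> Obj T" "q i \<in> Mor T (A i) (X i)" by simp_all
qed

context exact_functor
begin

lemma complex_image:
  assumes "is_complex T n A \<delta>"
  shows "is_complex S n (\<lambda>i. omap \<Phi> (A i)) (\<lambda>i. mmap \<Phi> (\<delta> i))"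
proof -
  have A: "A i \<in> Obj T" if "i \<le> n" for i using assms that by (simp add: is_complex_def)
  have \<delta>: "\<delta> i \<in> Mor T (A (i + 1)) (A i)" if "i < n" for i
    using assms that by (simp add: is_complex_def)
  have "mmap \<Phi> (\<delta> i) \<bullet>\<^bsub>S\<^esub> mmap \<Phi> (\<delta> (i + 1)) = Zero S (omap \<Phi> (A (i + 2))) (omap \<Phi> (A i))"
    if i: "i + 1 < n" for i
  proof -
    have ob: "A (i + 2) \<in> Obj T" "A (i + 1) \<in> Obj T" "A i \<in> Obj T"
      using A i by simp_all
    have m: "\<delta> (i + 1) \<in> Mor T (A (i + 2)) (A (i + 1))" "\<delta> i \<in> Mor T (A (i + 1)) (A i)"
      using \<delta>[of "i + 1"] \<delta>[of i] i by simp_all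
    have "\<delta> i \<bullet>\<^bsub>T\<^esub> \<delta> (i + 1) = Zero T (A (i + 2)) (A i)"
      using assms i by (simp add: is_complex_def)
    then show ?thesis
      using mmap_Comp[OF ob m] mmap_Zero[OF ob(1,3)] by simp
  qed
  then show ?thesis
    using A \<delta> omap_closed mmap_closed by (simp add: is_complex_def)
qed

text \<open>The connecting maps of the image triangles have to be corrected by \<open>\<Phi> (a[1]) \<cong> (\<Phi> a)[1]\<close>.\<close>

lemma convolution_image:
  assumes "is_convolution T n A \<delta> Y"
  shows "is_convolution S n (\<lambda>i. omap \<Phi> (A i)) (\<lambda>i. mmap \<Phi> (\<delta> i)) (omap \<Phi> Y)"
proof -
  obtain X p q r where cx: "is_complex T n A \<delta>" and ps: "postnikov_system T n A \<delta> X p q r"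
    and Y: "Y = X 0" using assms unfolding is_convolution_def by blast
  obtain \<eta> where \<eta>: "\<And>a b c f g h. (a, b, c, f, g, h) \<in> Tri T \<Longrightarrow>
    (omap \<Phi> a, omap \<Phi> b, omap \<Phi> c, mmap \<Phi> f, mmap \<Phi> g, \<eta> a \<bullet>\<^bsub>S\<^esub> mmap \<Phi> h) \<in> Tri S"
    using Tri_image by blast
  have A: "A i \<in> Obj T" if "i \<le> n" for i using cx that by (simp add: is_complex_def)
  have X: "X i \<in> Obj T" "q i \<in> Mor T (A i) (X i)" if "i \<le> n" for i
    using Dom.postnikov_system_objects[OF ps _ that] A by simp_all
  have "postnikov_system S n (\<lambda>i. omap \<Phi> (A i)) (\<lambda>i. mmap \<Phi> (\<delta> i)) (\<lambda>i. omap \<Phi> (X i))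
     (\<lambda>i. mmap \<Phi> (p i)) (\<lambda>i. mmap \<Phi> (q i)) (\<lambda>i. \<eta> (X (i + 1)) \<bullet>\<^bsub>S\<^esub> mmap \<Phi> (r i))"
  proof -
    have "mmap \<Phi> (\<delta> i) = mmap \<Phi> (p i) \<bullet>\<^bsub>S\<^esub> mmap \<Phi> (q (i + 1))" if "i < n" for i
      using mmap_Comp[OF A X(1) A X(2) Dom.postnikov_system_closed(3)[OF ps that]] ps that
      by (simp add: postnikov_system_def)
    then show ?thesis
      using ps \<eta> mmap_Id A by (simp add: postnikov_system_def)
  qed
  then show ?thesis
    using complex_image[OF cx] Y unfolding is_convolution_def by blast
qed

end

section \<open>Graded hom-spaces under fully faithful exact functors\<close>

locale fully_faithful_exact_functor = exact_functor +
  assumes ff: "fully_faithful T S \<Phi>"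
begin

lemma mmap_bij:
  "a \<in> Obj T \<Longrightarrow> b \<in> Obj T \<Longrightarrow> bij_betw (mmap \<Phi>) (Mor T a b) (Mor S (omap \<Phi> a) (omap \<Phi> b))"
  using ff by (simp add: fully_faithful_def)

lemma mmap_preimage:
  assumes "a \<in> Obj T" "b \<in> Obj T" "g \<in> Mor S (omap \<Phi> a) (omap \<Phi> b)"
  obtains f where "f \<in> Mor T a b" "mmap \<Phi> f = g"
  using mmap_bij[OF assms(1,2)] assms(3) that unfolding bij_betw_def by (metis imageE)

lemma mmap_eqD:
  assumes "mmap \<Phi> f = mmap \<Phi> g" "a \<in> Obj T" "b \<in> Obj T" "f \<in> Mor T a b" "g \<in> Mor T a b"
  shows "f = g"
  using mmap_bij[OF assms(2,3)] assms by (auto simp: bij_betw_def inj_on_def)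

lemma Hom_deg_linear_bij:
  assumes a: "a \<in> Obj T" and b: "b \<in> Obj T" and y: "iso_objects S (omap \<Phi> b) y"
  obtains \<theta> where "linear_map k (Hom_deg T i a b) (Hom_deg S i (omap \<Phi> a) y) \<theta>"
    "bij_betw \<theta> (carrier (Hom_deg T i a b)) (carrier (Hom_deg S i (omap \<Phi> a) y))"
proof -
  let ?b = "shift_obj T i b" and ?y = "shift_obj S i y"
  have "iso_objects S (omap \<Phi> ?b) ?y"
    using Cod.iso_objects_trans[OF shift_obj_iso[OF b] Cod.iso_objects_shift_obj[OF y]] .
  then obtain t where t: "is_iso S (omap \<Phi> ?b) ?y t" and ob: "?y \<in> Obj S"
    by (auto simp: iso_objects_def)
  have sb: "?b \<in> Obj T" and a': "omap \<Phi> a \<in> Obj S" and b': "omap \<Phi> ?b \<in> Obj S"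
    using a b Dom.shift_obj_closed omap_closed by auto
  have tm: "t \<in> Mor S (omap \<Phi> ?b) ?y" using t by (simp add: is_iso_def)
  show ?thesis
  proof (rule that)
    show "linear_map k (Hom_deg T i a b) (Hom_deg S i (omap \<Phi> a) y) (\<lambda>x. t \<bullet>\<^bsub>S\<^esub> mmap \<Phi> x)"
      unfolding Hom_deg_def
      by (rule linear_map_comp[OF mmap_linear[OF a sb] Cod.Comp_linear_right[OF a' b' ob tm]])
    show "bij_betw (\<lambda>x. t \<bullet>\<^bsub>S\<^esub> mmap \<Phi> x) (carrier (Hom_deg T i a b))
            (carrier (Hom_deg S i (omap \<Phi> a) y))"
      using bij_betw_trans[OF mmap_bij[OF a sb] Cod.bij_betw_Comp_iso[OF a' b' ob t]]
      by (simp add: Hom_deg_def comp_def)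
  qed
qed

lemma hom_dim_eq:
  assumes "a \<in> Obj T" "b \<in> Obj T"
  shows "hom_dim k S i (omap \<Phi> a) (omap \<Phi> b) = hom_dim k T i a b"
proof -
  have "iso_objects S (omap \<Phi> b) (omap \<Phi> b)"
    using assms(2) omap_closed Cod.iso_objects_refl by blast
  from Hom_deg_linear_bij[OF assms this, of i] show ?thesis
    unfolding hom_dim_def using vs_dim_eq_of_linear_bij by metis
qed

end

lemma Hom_star_trivial_iff:
  assumes "\<And>i. \<zero>\<^bsub>Hom_deg T i a b\<^esub> \<in> carrier (Hom_deg T i a b)"
  shows "carrier (Hom_star T a b) = {\<zero>\<^bsub>Hom_star T a b\<^esub>} \<longleftrightarrow>
    (\<forall>i. carrier (Hom_deg T i a b) = {\<zero>\<^bsub>Hom_deg T i a b\<^esub>})"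
proof
  let ?z = "\<lambda>i. \<zero>\<^bsub>Hom_deg T i a b\<^esub>"
  assume triv: "carrier (Hom_star T a b) = {\<zero>\<^bsub>Hom_star T a b\<^esub>}"
  have "x = ?z i" if "x \<in> carrier (Hom_deg T i a b)" for i x
  proof -
    have "finite {j. (?z(i := x)) j \<noteq> ?z j}"
      by (rule finite_subset[of _ "{i}"]) auto
    then have "?z(i := x) \<in> carrier (Hom_star T a b)"
      using that assms by (simp add: Hom_star_def)
    moreover have "\<zero>\<^bsub>Hom_star T a b\<^esub> = ?z" by (simp add: Hom_star_def)
    ultimately have "?z(i := x) = ?z" using triv by simp
    then show ?thesis by (metis fun_upd_same)
  qed
  then show "\<forall>i. carrier (Hom_deg T i a b) = {?z i}" using assms by blast
next
  assume "\<forall>i. carrier (Hom_deg T i a b) = {\<zero>\<^bsub>Hom_deg T i a b\<^esub>}"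
  then show "carrier (Hom_star T a b) = {\<zero>\<^bsub>Hom_star T a b\<^esub>}"
    by (auto simp: Hom_star_def)
qed

lemma (in triangulated_category) Hom_star_trivial_iff_Hom_deg:
  assumes "a \<in> Obj T" "b \<in> Obj T"
  shows "carrier (Hom_star T a b) = {\<zero>\<^bsub>Hom_star T a b\<^esub>} \<longleftrightarrow>
    (\<forall>i. carrier (Hom_deg T i a b) = {\<zero>\<^bsub>Hom_deg T i a b\<^esub>})"
  by (rule Hom_star_trivial_iff) (simp add: Hom_deg_def Zero_closed shift_obj_closed assms)

context fully_faithful_exact_functor
begin

lemma Hom_star_trivial_transfer:
  assumes a: "a \<in> Obj T" and b: "b \<in> Obj T" and y: "iso_objects S (omap \<Phi> b) y"
  shows "carrier (Hom_star S (omap \<Phi> a) y) = {\<zero>\<^bsub>Hom_star S (omap \<Phi> a) y\<^esub>} \<longleftrightarrow>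
    carrier (Hom_star T a b) = {\<zero>\<^bsub>Hom_star T a b\<^esub>}"
proof -
  have "carrier (Hom_deg T i a b) = {\<zero>\<^bsub>Hom_deg T i a b\<^esub>} \<longleftrightarrow>
    carrier (Hom_deg S i (omap \<Phi> a) y) = {\<zero>\<^bsub>Hom_deg S i (omap \<Phi> a) y\<^esub>}" for i
    using Hom_deg_linear_bij[OF assms, of i] trivial_iff_of_linear_bij by metis
  moreover have "y \<in> Obj S" "omap \<Phi> a \<in> Obj S"
    using y a omap_closed by (auto simp: iso_objects_def)
  ultimately show ?thesis
    using Dom.Hom_star_trivial_iff_Hom_deg Cod.Hom_star_trivial_iff_Hom_deg a b by simp
qed

section \<open>Lifting convolutions along fully faithful exact functors\<close>

lemma lift_complex:
  assumes A: "\<forall>i\<le>n. A i \<in> Obj T" and cx: "is_complex S n (\<lambda>i. omap \<Phi> (A i)) \<delta>'"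
  obtains \<delta> where "is_complex T n A \<delta>" "\<And>i. i < n \<Longrightarrow> mmap \<Phi> (\<delta> i) = \<delta>' i"
proof -
  have "\<exists>f. f \<in> Mor T (A (i + 1)) (A i) \<and> mmap \<Phi> f = \<delta>' i" if "i < n" for i
  proof -
    have "A (i + 1) \<in> Obj T" "A i \<in> Obj T" "\<delta>' i \<in> Mor S (omap \<Phi> (A (i + 1))) (omap \<Phi> (A i))"
      using that A cx by (auto simp: is_complex_def)
    then show ?thesis by (rule mmap_preimage) blast
  qed
  then obtain \<delta> where \<delta>: "\<And>i. i < n \<Longrightarrow> \<delta> i \<in> Mor T (A (i + 1)) (A i)"
    "\<And>i. i < n \<Longrightarrow> mmap \<Phi> (\<delta> i) = \<delta>' i" by metis
  have "\<delta> i \<bullet>\<^bsub>T\<^esub> \<delta> (i + 1) = Zero T (A (i + 2)) (A i)" if i: "i + 1 < n" for i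
  proof (rule mmap_eqD)
    have ob: "A (i + 2) \<in> Obj T" "A (i + 1) \<in> Obj T" "A i \<in> Obj T" using A i by auto
    have m: "\<delta> (i + 1) \<in> Mor T (A (i + 2)) (A (i + 1))" "\<delta> i \<in> Mor T (A (i + 1)) (A i)"
      using \<delta>(1)[of "i + 1"] \<delta>(1)[of i] i by simp_all
    show "A (i + 2) \<in> Obj T" "A i \<in> Obj T" by fact+
    show "\<delta> i \<bullet>\<^bsub>T\<^esub> \<delta> (i + 1) \<in> Mor T (A (i + 2)) (A i)"
      by (rule Dom.Comp_closed[OF ob m])
    show "Zero T (A (i + 2)) (A i) \<in> Mor T (A (i + 2)) (A i)" using ob by (simp add: Dom.Zero_closed)
    show "mmap \<Phi> (\<delta> i \<bullet>\<^bsub>T\<^esub> \<delta> (i + 1)) = mmap \<Phi> (Zero T (A (i + 2)) (A i))"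
      using mmap_Comp[OF ob m] mmap_Zero[OF ob(1,3)] \<delta>(2)[of i] \<delta>(2)[of "i + 1"] cx i
      by (simp add: is_complex_def)
  qed
  then have "is_complex T n A \<delta>" using A \<delta>(1) by (simp add: is_complex_def)
  then show ?thesis using \<delta>(2) that by blast
qed

text \<open>
  The isomorphism \<open>w\<close> and the equation \<open>w \<bullet> \<Phi> (q 0) = q' 0\<close> are the induction invariant: in the next
  step, \<open>p0\<close> is the lift of \<open>p' 0 \<bullet> w\<close>, and the equation makes \<open>p0 \<bullet> q 0\<close> a lift of the same map as
  the differential.
\<close>

lemma lift_postnikov_system:
  assumes "is_complex T n A \<delta>"
    and "postnikov_system S n (\<lambda>i. omap \<Phi> (A i)) (\<lambda>i. mmap \<Phi> (\<delta> i)) X' p' q' r'"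
  shows "\<exists>X p q r w. postnikov_system T n A \<delta> X p q r \<and>
    is_iso S (omap \<Phi> (X 0)) (X' 0) w \<and> w \<bullet>\<^bsub>S\<^esub> mmap \<Phi> (q 0) = q' 0"
  using assms
proof (induction n arbitrary: A \<delta> X' p' q' r')
  case 0
  then have A: "A 0 \<in> Obj T" by (simp add: is_complex_def)
  have X': "X' 0 = omap \<Phi> (A 0)" "q' 0 = Id S (omap \<Phi> (A 0))"
    using 0 by (simp_all add: postnikov_system_def)
  have "postnikov_system T 0 A \<delta> A p' (\<lambda>i. Id T (A i)) p'" for p'
    by (simp add: postnikov_system_def)
  moreover have "is_iso S (omap \<Phi> (A 0)) (X' 0) (Id S (omap \<Phi> (A 0)))"
    using X' A omap_closed Cod.is_iso_Id by simp
  moreover have "Id S (omap \<Phi> (A 0)) \<bullet>\<^bsub>S\<^esub> mmap \<Phi> (Id T (A 0)) = q' 0"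
    using X'(2) mmap_Id[OF A] omap_closed[OF A] Cod.Id_left[OF _ _ Cod.Id_closed] by simp
  ultimately show ?case by blast
next
  case (Suc n)
  have cx: "is_complex T n (\<lambda>i. A (Suc i)) (\<lambda>i. \<delta> (Suc i))" and A0: "A 0 \<in> Obj T"
    and \<delta>0: "\<delta> 0 \<in> Mor T (A 1) (A 0)"
    using Suc.prems(1) is_complex_tail[OF Suc.prems(1)] by (simp_all add: is_complex_def)
  have A1: "A 1 \<in> Obj T" using cx by (simp add: is_complex_def)
  have ps: "postnikov_system S n (\<lambda>i. omap \<Phi> (A (Suc i))) (\<lambda>i. mmap \<Phi> (\<delta> (Suc i)))
       (\<lambda>i. X' (Suc i)) (\<lambda>i. p' (Suc i)) (\<lambda>i. q' (Suc i)) (\<lambda>i. r' (Suc i))"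
    and tri': "(X' 1, omap \<Phi> (A 0), X' 0, p' 0, q' 0, r' 0) \<in> Tri S"
    and \<delta>0': "mmap \<Phi> (\<delta> 0) = p' 0 \<bullet>\<^bsub>S\<^esub> q' 1"
    using Suc.prems(2) by (auto simp: postnikov_system_Suc)
  note cl' = Cod.Tri_closed[OF tri']
  obtain X p q r w where lift: "postnikov_system T n (\<lambda>i. A (Suc i)) (\<lambda>i. \<delta> (Suc i)) X p q r"
    and w: "is_iso S (omap \<Phi> (X 0)) (X' 1) w" "w \<bullet>\<^bsub>S\<^esub> mmap \<Phi> (q 0) = q' 1"
    using Suc.IH[OF cx ps] by auto
  have X0: "X 0 \<in> Obj T" and q0: "q 0 \<in> Mor T (A 1) (X 0)"
    using Dom.postnikov_system_objects[OF lift, of 0] cx by (simp_all add: is_complex_def)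
  have wm: "w \<in> Mor S (omap \<Phi> (X 0)) (X' 1)" using w(1) by (simp add: is_iso_def)
  note im = omap_closed[OF X0] omap_closed[OF A0] omap_closed[OF A1]
  obtain p0 where p0: "p0 \<in> Mor T (X 0) (A 0)" "mmap \<Phi> p0 = p' 0 \<bullet>\<^bsub>S\<^esub> w"
    using mmap_preimage[OF X0 A0 Cod.Comp_closed[OF im(1) cl'(1) im(2) wm cl'(4)]] by blast
  have \<delta>_eq: "\<delta> 0 = p0 \<bullet>\<^bsub>T\<^esub> q 0"
  proof (rule mmap_eqD[OF _ A1 A0 \<delta>0 Dom.Comp_closed[OF A1 X0 A0 q0 p0(1)]])
    have "mmap \<Phi> (p0 \<bullet>\<^bsub>T\<^esub> q 0) = (p' 0 \<bullet>\<^bsub>S\<^esub> w) \<bullet>\<^bsub>S\<^esub> mmap \<Phi> (q 0)"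
      using mmap_Comp[OF A1 X0 A0 q0 p0(1)] p0(2) by simp
    also have "\<dots> = p' 0 \<bullet>\<^bsub>S\<^esub> q' 1"
      using Cod.Comp_assoc[OF im(3,1) cl'(1) im(2) mmap_closed[OF A1 X0 q0] wm cl'(4)] w(2) by simp
    finally show "mmap \<Phi> (\<delta> 0) = mmap \<Phi> (p0 \<bullet>\<^bsub>T\<^esub> q 0)" using \<delta>0' by simp
  qed
  obtain x0 q0' r0 where tri: "(X 0, A 0, x0, p0, q0', r0) \<in> Tri T"
    using Dom.TR1_cone[OF X0 A0 p0(1)] by blast
  note cl = Dom.Tri_closed[OF tri]
  obtain h where tri\<Phi>: "(omap \<Phi> (X 0), omap \<Phi> (A 0), omap \<Phi> x0, mmap \<Phi> p0, mmap \<Phi> q0', h) \<in> Tri S"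
    using Tri_image tri by metis
  have "Id S (omap \<Phi> (A 0)) \<bullet>\<^bsub>S\<^esub> mmap \<Phi> p0 = p' 0 \<bullet>\<^bsub>S\<^esub> w"
    using Cod.Id_left[OF im(1,2) mmap_closed[OF X0 A0 p0(1)]] p0(2) by simp
  then obtain w0 where w0: "triangle_morphism S
      (omap \<Phi> (X 0), omap \<Phi> (A 0), omap \<Phi> x0, mmap \<Phi> p0, mmap \<Phi> q0', h)
      (X' 1, omap \<Phi> (A 0), X' 0, p' 0, q' 0, r' 0) w (Id S (omap \<Phi> (A 0))) w0"
    using Cod.TR3[OF tri\<Phi> tri' wm Cod.Id_closed[OF im(2)]] by blast
  have iso: "is_iso S (omap \<Phi> x0) (X' 0) w0"
    by (rule Cod.triangle_morphism_iso[OF tri\<Phi> tri' w0 w(1) Cod.is_iso_Id[OF im(2)]])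
  have w0q: "w0 \<bullet>\<^bsub>S\<^esub> mmap \<Phi> q0' = q' 0"
    using w0 Cod.Id_right[OF im(2) cl'(3,5)] by (simp add: triangle_morphism_def)
  have "postnikov_system T (Suc n) A \<delta> (case_nat x0 X) (case_nat p0 p) (case_nat q0' q) (case_nat r0 r)"
    using lift tri \<delta>_eq by (simp add: postnikov_system_Suc)
  then show ?case
    using iso w0q by (metis old.nat.simps(4))
qed

lemma lift_convolution:
  assumes A: "\<forall>i\<le>n. A i \<in> Obj T" and conv: "is_convolution S n (\<lambda>i. omap \<Phi> (A i)) \<delta>' Y'"
  obtains \<delta> Y where "is_convolution T n A \<delta> Y" "iso_objects S (omap \<Phi> Y) Y'"
proof -
  obtain X' p' q' r' where cx: "is_complex S n (\<lambda>i. omap \<Phi> (A i)) \<delta>'"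
    and ps: "postnikov_system S n (\<lambda>i. omap \<Phi> (A i)) \<delta>' X' p' q' r'" and Y': "Y' = X' 0"
    using conv unfolding is_convolution_def by blast
  obtain \<delta> where \<delta>: "is_complex T n A \<delta>" "\<And>i. i < n \<Longrightarrow> mmap \<Phi> (\<delta> i) = \<delta>' i"
    using lift_complex[OF A cx] by blast
  have "postnikov_system S n (\<lambda>i. omap \<Phi> (A i)) (\<lambda>i. mmap \<Phi> (\<delta> i)) X' p' q' r'"
    using ps \<delta>(2) by (simp add: postnikov_system_def)
  then obtain X p q r w where l: "postnikov_system T n A \<delta> X p q r"
    "is_iso S (omap \<Phi> (X 0)) (X' 0) w"
    using lift_postnikov_system[OF \<delta>(1)] by blast
  have "X 0 \<in> Obj T" "X' 0 \<in> Obj S"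
    using Dom.postnikov_system_objects(1)[OF l(1) A le0] Cod.postnikov_system_objects(1)[OF ps _ le0] A omap_closed
    by simp_all
  then have "iso_objects S (omap \<Phi> (X 0)) (X' 0)"
    using l(2) omap_closed by (auto simp: iso_objects_def)
  moreover have "is_convolution T n A \<delta> (X 0)"
    unfolding is_convolution_def using \<delta>(1) l(1) by blast
  ultimately show ?thesis using that Y' by blast
qed

lemma nonneg_convolution_image:
  assumes "nonneg_convolution T d e C \<delta> Y"
  shows "nonneg_convolution S d e (\<lambda>j. omap \<Phi> (C j)) (\<lambda>j. mmap \<Phi> (\<delta> j)) (omap \<Phi> Y)"
  using assms convolution_image omap_zero_object by (auto simp: nonneg_convolution_def)

text \<open>
  For \<open>d < 0\<close> the convolution is a zero object, and any zero object of the source category is a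
  lift of it up to isomorphism.
\<close>

lemma lift_nonneg_convolution:
  assumes ed: "e \<le> d" and C: "\<forall>j \<in> {e..d}. C j \<in> Obj T"
    and conv: "nonneg_convolution S d e (\<lambda>j. omap \<Phi> (C j)) \<delta>' Y'"
  obtains \<delta> Y where "nonneg_convolution T d e C \<delta> Y" "iso_objects S (omap \<Phi> Y) Y'"
proof (cases "d < 0")
  case True
  obtain z where z: "zero_object T z" using Dom.zero_object_exists by blast
  have "zero_object S Y'" using conv True by (simp add: nonneg_convolution_def)
  then have "iso_objects S (omap \<Phi> z) Y'"
    using Cod.zero_objects_iso omap_zero_object[OF z] by blast
  moreover have "nonneg_convolution T d e C \<delta>'' z" for \<delta>''
    using True z by (simp add: nonneg_convolution_def)
  ultimately show ?thesis using that by blast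
next
  case False
  define m where "m = max 0 e"
  have m: "m \<le> d" "e \<le> m" using ed False by (auto simp: m_def)
  have "\<forall>i\<le>nat (d - m). C (m + int i) \<in> Obj T"
    using C m by auto
  moreover have "is_convolution S (nat (d - m)) (\<lambda>i. omap \<Phi> (C (m + int i))) (\<lambda>i. \<delta>' (m + int i + 1)) Y'"
    using conv False by (simp add: nonneg_convolution_def m_def)
  ultimately obtain \<delta> Y where Y: "is_convolution T (nat (d - m)) (\<lambda>i. C (m + int i)) \<delta> Y"
    "iso_objects S (omap \<Phi> Y) Y'"
    using lift_convolution[of "nat (d - m)" "\<lambda>i. C (m + int i)"] by blast
  \<comment> \<open>\<open>\<delta> i\<close> has source \<open>C (m + i + 1)\<close>, hence is the differential of index \<open>m + i + 1\<close>\<close>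
  have "nonneg_convolution T d e C (\<lambda>j. \<delta> (nat (j - 1 - m))) Y"
    using Y(1) False by (simp add: nonneg_convolution_def m_def)
  then show ?thesis using Y(2) that by blast
qed

end

lemma (in triangulated_category) nonneg_convolution_closed:
  assumes "nonneg_convolution T d e C \<delta> Y"
  shows "Y \<in> Obj T"
proof (cases "d < 0")
  case True
  then show ?thesis using assms by (simp add: nonneg_convolution_def zero_object_def)
next
  case False
  then obtain A n \<delta>' X p q r where "\<forall>i\<le>n. A i \<in> Obj T" "postnikov_system T n A \<delta>' X p q r" "Y = X 0"
    using assms unfolding nonneg_convolution_def is_convolution_def is_complex_def by auto
  then show ?thesis using postnikov_system_objects(1) by blast
qed

section \<open>Invariance of P-stability\<close>

theorem theorem1:
  fixes k :: "('k, 'r) ring_scheme"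
    and \<T> :: "('o, 'm, 'k, 'z) tcat_scheme"
    and \<S> :: "('o2, 'm2, 'k, 'z2) tcat_scheme"
    and \<Phi> :: "('o, 'm, 'o2, 'm2) fdata"
    and d e :: int
    and C :: "int \<Rightarrow> 'o"
    and N :: "int \<Rightarrow> int \<Rightarrow> nat"
    and A :: 'o
  assumes "field k"
    and "triangulated_category k \<T>"
    and "triangulated_category k \<S>"
    and "exact_functor k \<T> \<S> \<Phi>"
    and "fully_faithful \<T> \<S> \<Phi>"
    and "P_datum \<T> d e C N"
    and "A \<in> Obj \<T>"
  shows "P_stable k \<T> d e C N A \<longleftrightarrow>
         P_stable k \<S> d e (\<lambda>j. omap \<Phi> (C j)) N (omap \<Phi> A)"
proof -
  interpret fully_faithful_exact_functor k \<T> \<S> \<Phi>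
    using assms(4,5) by (intro fully_faithful_exact_functor.intro fully_faithful_exact_functor_axioms.intro)
  have ed: "e \<le> d" and C: "\<forall>j \<in> {e..d}. C j \<in> Obj \<T>"
    using assms(6) by (auto simp: P_datum_def)
  have dims: "(\<forall>j \<in> {e..d}. \<forall>i. hom_dim k \<T> i (C j) A = enat (N i j)) \<longleftrightarrow>
    (\<forall>j \<in> {e..d}. \<forall>i. hom_dim k \<S> i (omap \<Phi> (C j)) (omap \<Phi> A) = enat (N i j))"
    using hom_dim_eq C assms(7) by simp
  have conv: "(\<exists>\<delta> Y. nonneg_convolution \<T> d e C \<delta> Y \<and>
        carrier (Hom_star \<T> A Y) = {\<zero>\<^bsub>Hom_star \<T> A Y\<^esub>}) \<longleftrightarrow>
    (\<exists>\<delta> Y. nonneg_convolution \<S> d e (\<lambda>j. omap \<Phi> (C j)) \<delta> Y \<and>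
        carrier (Hom_star \<S> (omap \<Phi> A) Y) = {\<zero>\<^bsub>Hom_star \<S> (omap \<Phi> A) Y\<^esub>})" (is "?L \<longleftrightarrow> ?R")
  proof
    assume ?L
    then obtain \<delta> Y where Y: "nonneg_convolution \<T> d e C \<delta> Y"
      "carrier (Hom_star \<T> A Y) = {\<zero>\<^bsub>Hom_star \<T> A Y\<^esub>}" by blast
    have ob: "Y \<in> Obj \<T>" by (rule Dom.nonneg_convolution_closed[OF Y(1)])
    show ?R
      using nonneg_convolution_image[OF Y(1)] Y(2)
        Hom_star_trivial_transfer[OF assms(7) ob Cod.iso_objects_refl[OF omap_closed[OF ob]]] by blast
  next
    assume ?R
    then obtain \<delta>' Y' where Y': "nonneg_convolution \<S> d e (\<lambda>j. omap \<Phi> (C j)) \<delta>' Y'"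
      "carrier (Hom_star \<S> (omap \<Phi> A) Y') = {\<zero>\<^bsub>Hom_star \<S> (omap \<Phi> A) Y'\<^esub>}" by blast
    obtain \<delta> Y where Y: "nonneg_convolution \<T> d e C \<delta> Y" "iso_objects \<S> (omap \<Phi> Y) Y'"
      using lift_nonneg_convolution[OF ed C Y'(1)] by blast
    show ?L
      using Y Y'(2) Hom_star_trivial_transfer[OF assms(7) Dom.nonneg_convolution_closed[OF Y(1)] Y(2)]
      by blast
  qed
  show ?thesis
    unfolding P_stable_def using dims conv by blast
qed

end
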